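(* For every commutative semiring $S$, the set $\mathrm{ZId}(S)$ of $z$-ideals of $S$, ordered by inclusion, is a coherent frame. Its compact elements are the finite joins of principal $z$-closures $\langle a_1\rangle_z\vee_z\cdots\vee_z\langle a_n\rangle_z$ with $a_1,\dots,a_n\in S$. Consequently the space $\mathrm{Spec}_z(S)$ of prime $z$-ideals of $S$, endowed with the hull-kernel topology, is spectral.
   Context: A semiring here is commutative with $0$ and $1$: $(S,+,0)$ and $(S,\cdot,1)$ are commutative monoids, multiplication distributes over addition, and $0s=0$ for all $s$. An ideal of $S$ is a non-empty subset closed under addition and under multiplication by arbitrary elements of $S$; prime and maximal ideals are proper. $\mathrm{Max}(S)$ is the set of maximal ideals and $\mathcal M(a)=\{M\in\mathrm{Max}(S)\mid a\in M\}$. An ideal $I$ is a $z$-ideal if $a\in I$, $b\in S$ and $\mathcal M(a)=\mathcal M(b)$ imply $b\in I$. For an ideal $I$, its $z$-closure $\mathfrak{cl}_z(I)$ is the intersection of all $z$-ideals containing $I$; $\langle a\rangle_z$ denotes the $z$-closure of the principal ideal $\langle a\rangle$ (the principal $z$-closure of $a$). In $\mathrm{ZId}(S)$ the meet is $I\cap J$ and joins are $\bigvee^z_\lambda I_\lambda=\mathfrak{cl}_z(\sum_\lambda I_\lambda)$, with binary join written $\vee_z$. A frame is a complete lattice in which finite meets distribute over arbitrary joins. An element $c$ is compact if $c\leqslant\bigvee A$ implies $c\leqslant\bigvee A_0$ for some finite $A_0\subseteq A$. A frame is coherent if its top element is compact, every element is a join of compact elements, and compact elements are closed under finite meets. The hull-kernel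 topology on $\mathrm{Spec}_z(S)$ has as closed sets the sets $\{P\in\mathrm{Spec}_z(S)\mid A\subseteq P\}$ for $A\subseteq S$. A topological space is spectral if it is quasi-compact and sober (every irreducible closed subset has a unique generic point) and has a basis of quasi-compact open sets closed under finite intersections. *)

theory Defs
  imports "HOL-Analysis.Abstract_Topology" "HOL-Algebra.Complete_Lattice" "HOL-Algebra.Ideal"
begin

section \<open>Commutative semirings and their ideals\<close>

text \<open>The zero semiring, in which \<open>\<zero> = \<one>\<close>, is not excluded.\<close>

locale csemiring = semiring S + comm_monoid S for S (structure)

definition semiring_ideal :: "('a, 'm) ring_scheme \<Rightarrow> 'a set \<Rightarrow> bool" where
  "semiring_ideal S I \<longleftrightarrow>
     I \<subseteq> carrier S \<and> I \<noteq> {} \<and>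
     (\<forall>a\<in>I. \<forall>b\<in>I. a \<oplus>\<^bsub>S\<^esub> b \<in> I) \<and>
     (\<forall>s\<in>carrier S. \<forall>a\<in>I. s \<otimes>\<^bsub>S\<^esub> a \<in> I)"

definition prime_semiring_ideal :: "('a, 'm) ring_scheme \<Rightarrow> 'a set \<Rightarrow> bool" where
  "prime_semiring_ideal S P \<longleftrightarrow>
     semiring_ideal S P \<and> P \<noteq> carrier S \<and>
     (\<forall>a\<in>carrier S. \<forall>b\<in>carrier S. a \<otimes>\<^bsub>S\<^esub> b \<in> P \<longrightarrow> a \<in> P \<or> b \<in> P)"

definition maximal_semiring_ideal :: "('a, 'm) ring_scheme \<Rightarrow> 'a set \<Rightarrow> bool" where
  "maximal_semiring_ideal S M \<longleftrightarrow>
     semiring_ideal S M \<and> M \<noteq> carrier S \<and>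
     (\<forall>J. semiring_ideal S J \<and> M \<subseteq> J \<longrightarrow> J = M \<or> J = carrier S)"

text \<open>The sum of a family of ideals: all finite sums of elements taken from members of the
  family; the empty family has sum \<open>{\<zero>}\<close>.\<close>

definition ideal_sum :: "('a, 'm) ring_scheme \<Rightarrow> 'a set set \<Rightarrow> 'a set" where
  "ideal_sum S \<I> =
     {finsum S x \<F> | x \<F>. finite \<F> \<and> \<F> \<subseteq> \<I> \<and> (\<forall>I\<in>\<F>. x I \<in> I)}"

section \<open>z-ideals\<close>

definition maximals_containing :: "('a, 'm) ring_scheme \<Rightarrow> 'a \<Rightarrow> 'a set set" where
  "maximals_containing S a = {M. maximal_semiring_ideal S M \<and> a \<in> M}"

definition z_ideal :: "('a, 'm) ring_scheme \<Rightarrow> 'a set \<Rightarrow> bool" where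
  "z_ideal S I \<longleftrightarrow>
     semiring_ideal S I \<and>
     (\<forall>a\<in>I. \<forall>b\<in>carrier S. maximals_containing S a = maximals_containing S b \<longrightarrow> b \<in> I)"

definition z_closure :: "('a, 'm) ring_scheme \<Rightarrow> 'a set \<Rightarrow> 'a set" where
  "z_closure S I = \<Inter>{J. z_ideal S J \<and> I \<subseteq> J}"

definition principal_z_closure :: "('a, 'm) ring_scheme \<Rightarrow> 'a \<Rightarrow> 'a set" where
  "principal_z_closure S a = z_closure S (PIdl\<^bsub>S\<^esub> a)"

definition z_join :: "('a, 'm) ring_scheme \<Rightarrow> 'a set set \<Rightarrow> 'a set" where
  "z_join S \<I> = z_closure S (ideal_sum S \<I>)"

definition ZId :: "('a, 'm) ring_scheme \<Rightarrow> 'a set gorder" where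
  "ZId S = \<lparr>carrier = {I. z_ideal S I}, eq = (=), le = (\<subseteq>)\<rparr>"

section \<open>Coherent frames\<close>

locale frame = complete_lattice L for L (structure) +
  assumes meet_sup_distrib:
    "\<lbrakk>a \<in> carrier L; B \<subseteq> carrier L\<rbrakk> \<Longrightarrow> a \<sqinter> (\<Squnion>B) = \<Squnion>((\<lambda>b. a \<sqinter> b) ` B)"

definition compact_element :: "('a, 'm) gorder_scheme \<Rightarrow> 'a \<Rightarrow> bool" where
  "compact_element L c \<longleftrightarrow>
     c \<in> carrier L \<and>
     (\<forall>A \<subseteq> carrier L. c \<sqsubseteq>\<^bsub>L\<^esub> \<Squnion>\<^bsub>L\<^esub>A \<longrightarrow>
        (\<exists>A\<^sub>0 \<subseteq> A. finite A\<^sub>0 \<and> c \<sqsubseteq>\<^bsub>L\<^esub> \<Squnion>\<^bsub>L\<^esub>A\<^sub>0))"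

locale coherent_frame = frame L for L (structure) +
  assumes top_compact: "compact_element L \<top>"
    and join_of_compacts:
      "x \<in> carrier L \<Longrightarrow> \<exists>A \<subseteq> {c. compact_element L c}. x = \<Squnion>A"
    and meet_compact:
      "\<lbrakk>compact_element L c; compact_element L d\<rbrakk> \<Longrightarrow> compact_element L (c \<sqinter> d)"

section \<open>Spectral spaces\<close>

definition irreducible_closed :: "'a topology \<Rightarrow> 'a set \<Rightarrow> bool" where
  "irreducible_closed X C \<longleftrightarrow>
     closedin X C \<and> C \<noteq> {} \<and>
     (\<forall>A B. closedin X A \<and> closedin X B \<and> C = A \<union> B \<longrightarrow> C = A \<or> C = B)"

definition sober_space :: "'a topology \<Rightarrow> bool" where
  "sober_space X \<longleftrightarrow>
     (\<forall>C. irreducible_closed X C \<longrightarrow> (\<exists>!x. x \<in> topspace X \<and> X closure_of {x} = C))"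

text \<open>In a quasi-compact space the whole space, which is the intersection of the empty family,
  may be added to any basis of quasi-compact open sets; hence binary intersections suffice.\<close>

definition spectral_space :: "'a topology \<Rightarrow> bool" where
  "spectral_space X \<longleftrightarrow>
     compact_space X \<and> sober_space X \<and>
     (\<exists>\<B>. (\<forall>U\<in>\<B>. openin X U \<and> compactin X U) \<and>
          (\<forall>U. openin X U \<longrightarrow> (\<exists>\<U> \<subseteq> \<B>. U = \<Union>\<U>)) \<and>
          (\<forall>U\<in>\<B>. \<forall>V\<in>\<B>. U \<inter> V \<in> \<B>))"

section \<open>The prime z-spectrum\<close>

definition Spec_z :: "('a, 'm) ring_scheme \<Rightarrow> 'a set set" where
  "Spec_z S = {P. prime_semiring_ideal S P \<and> z_ideal S P}"

definition z_hull :: "('a, 'm) ring_scheme \<Rightarrow> 'a set \<Rightarrow> 'a set set" where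
  "z_hull S A = {P \<in> Spec_z S. A \<subseteq> P}"

definition hull_kernel_topology :: "('a, 'm) ring_scheme \<Rightarrow> 'a set topology" where
  "hull_kernel_topology S = topology (\<lambda>U. \<exists>A \<subseteq> carrier S. U = Spec_z S - z_hull S A)"

text \<open>The sets above satisfy the axioms for open sets, so that \<^const>\<open>topology\<close> yields the
  intended space.\<close>

lemma (in csemiring) z_hull_Un:
  assumes "A \<subseteq> carrier S" "B \<subseteq> carrier S"
  shows "z_hull S A \<union> z_hull S B = z_hull S {a \<otimes> b | a b. a \<in> A \<and> b \<in> B}"
proof (intro Set.set_eqI iffI)
  fix P assume "P \<in> z_hull S A \<union> z_hull S B"
  then have P: "P \<in> Spec_z S" and AB: "A \<subseteq> P \<or> B \<subseteq> P"
    by (auto simp: z_hull_def)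
  from P have absorb: "s \<otimes> a \<in> P" "a \<otimes> s \<in> P" if "s \<in> carrier S" "a \<in> P" for s a
    using that m_comm
    by (auto simp: Spec_z_def prime_semiring_ideal_def semiring_ideal_def subset_iff)
  have "a \<otimes> b \<in> P" if "a \<in> A" "b \<in> B" for a b
    using that AB absorb assms by blast
  with P show "P \<in> z_hull S {a \<otimes> b | a b. a \<in> A \<and> b \<in> B}"
    by (auto simp: z_hull_def)
next
  fix P assume "P \<in> z_hull S {a \<otimes> b | a b. a \<in> A \<and> b \<in> B}"
  then have P: "P \<in> Spec_z S" and prod: "\<And>a b. a \<in> A \<Longrightarrow> b \<in> B \<Longrightarrow> a \<otimes> b \<in> P"
    by (auto simp: z_hull_def)
  have "a \<in> P \<or> b \<in> P" if "a \<in> A" "b \<in> B" for a b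
    using P prod[OF that] that assms by (auto simp: Spec_z_def prime_semiring_ideal_def)
  then have "A \<subseteq> P \<or> B \<subseteq> P" by blast
  with P show "P \<in> z_hull S A \<union> z_hull S B"
    by (auto simp: z_hull_def)
qed

lemma (in csemiring) istopology_hull_kernel:
  "istopology (\<lambda>U. \<exists>A \<subseteq> carrier S. U = Spec_z S - z_hull S A)"
  unfolding istopology_def
proof (intro conjI allI impI)
  fix U V
  assume "\<exists>A \<subseteq> carrier S. U = Spec_z S - z_hull S A"
    and "\<exists>A \<subseteq> carrier S. V = Spec_z S - z_hull S A"
  then obtain A B where AB: "A \<subseteq> carrier S" "B \<subseteq> carrier S"
    and U: "U = Spec_z S - z_hull S A" and V: "V = Spec_z S - z_hull S B"
    by blast
  have "U \<inter> V = Spec_z S - z_hull S {a \<otimes> b | a b. a \<in> A \<and> b \<in> B}"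
    unfolding U V z_hull_Un[OF AB, symmetric] by blast
  moreover have "{a \<otimes> b | a b. a \<in> A \<and> b \<in> B} \<subseteq> carrier S"
    using AB by auto
  ultimately show "\<exists>A \<subseteq> carrier S. U \<inter> V = Spec_z S - z_hull S A"
    by blast
next
  fix \<U> assume "\<forall>U\<in>\<U>. \<exists>A \<subseteq> carrier S. U = Spec_z S - z_hull S A"
  then obtain A where A: "\<And>U. U \<in> \<U> \<Longrightarrow> A U \<subseteq> carrier S \<and> U = Spec_z S - z_hull S (A U)"
    by metis
  have "P \<in> \<Union>\<U> \<longleftrightarrow> P \<in> Spec_z S - z_hull S (\<Union>U\<in>\<U>. A U)" for P
  proof -
    have "P \<in> U \<longleftrightarrow> P \<in> Spec_z S \<and> \<not> A U \<subseteq> P" if "U \<in> \<U>" for U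
      using A[OF that] by (auto simp: z_hull_def)
    then show ?thesis by (auto simp: z_hull_def)
  qed
  then have "\<Union>\<U> = Spec_z S - z_hull S (\<Union>U\<in>\<U>. A U)" by blast
  moreover have "(\<Union>U\<in>\<U>. A U) \<subseteq> carrier S" using A by blast
  ultimately show "\<exists>A \<subseteq> carrier S. \<Union>\<U> = Spec_z S - z_hull S A" by blast
qed

lemma (in csemiring) openin_hull_kernel:
  "openin (hull_kernel_topology S) U \<longleftrightarrow> (\<exists>A \<subseteq> carrier S. U = Spec_z S - z_hull S A)"
  unfolding hull_kernel_topology_def by (simp add: istopology_hull_kernel topology_inverse')

lemma (in csemiring) topspace_hull_kernel: "topspace (hull_kernel_topology S) = Spec_z S"
proof
  show "topspace (hull_kernel_topology S) \<subseteq> Spec_z S"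
    unfolding topspace_def openin_hull_kernel by blast
  have "z_hull S {\<one>} = {}"
  proof -
    have False if P: "P \<in> Spec_z S" and one: "\<one> \<in> P" for P
    proof -
      have id: "semiring_ideal S P" and ne: "P \<noteq> carrier S"
        using P by (auto simp: Spec_z_def prime_semiring_ideal_def)
      have "s \<in> P" if s: "s \<in> carrier S" for s
      proof -
        have "s \<otimes> \<one> \<in> P" using id s one unfolding semiring_ideal_def by blast
        then show ?thesis unfolding r_one[OF s] .
      qed
      with id ne show False by (auto simp: semiring_ideal_def)
    qed
    then show ?thesis by (auto simp: z_hull_def)
  qed
  then have "openin (hull_kernel_topology S) (Spec_z S)"
    unfolding openin_hull_kernel by (intro exI[of _ "{\<one>}"]) auto
  then show "Spec_z S \<subseteq> topspace (hull_kernel_topology S)"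
    by (rule openin_subset)
qed

lemma (in csemiring) closedin_hull_kernel:
  "closedin (hull_kernel_topology S) C \<longleftrightarrow> (\<exists>A \<subseteq> carrier S. C = z_hull S A)"
proof -
  have "C \<subseteq> Spec_z S \<and> Spec_z S - C = Spec_z S - z_hull S A \<longleftrightarrow> C = z_hull S A" for A
    by (auto simp: z_hull_def)
  then show ?thesis
    unfolding closedin_def topspace_hull_kernel openin_hull_kernel by blast
qed

end

theory Submission
  imports Defs
begin

text \<open>
  The \<open>z\<close>-closure operator is algebraic: the union of the \<open>z\<close>-closures of the finite subsets of a
  set is already a \<open>z\<close>-ideal. It is also multiplicative: since maximal ideals are prime,
  \<open>x\<close> and \<open>x\<^sup>2\<close> lie in the same maximal ideals and the quotient \<open>(K : x)\<close> of a \<open>z\<close>-ideal is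
  a \<open>z\<close>-ideal, whence the intersection of the closures of \<open>X\<close> and \<open>Y\<close> is the closure of the
  set of products \<open>xy\<close>. Algebraicity identifies the compact elements with the closures of finite
  sets, and multiplicativity gives frame distributivity and stability of compact elements under
  meets. Together with Zorn's lemma they also show that every \<open>z\<close>-ideal is an intersection of
  prime \<open>z\<close>-ideals, so that compactness in the frame turns into quasi-compactness of the
  basic open sets of the \<open>z\<close>-spectrum.
\<close>

section \<open>Ideals of a commutative semiring\<close>

lemma semiring_idealD:
  assumes "semiring_ideal S I"
  shows "I \<subseteq> carrier S" "\<And>a. a \<in> I \<Longrightarrow> a \<in> carrier S" "I \<noteq> {}"
    "\<And>a b. a \<in> I \<Longrightarrow> b \<in> I \<Longrightarrow> a \<oplus>\<^bsub>S\<^esub> b \<in> I"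
    "\<And>s a. s \<in> carrier S \<Longrightarrow> a \<in> I \<Longrightarrow> s \<otimes>\<^bsub>S\<^esub> a \<in> I"
  using assms by (auto simp: semiring_ideal_def)

lemma z_idealD:
  assumes "z_ideal S I"
  shows "semiring_ideal S I"
    "\<And>a b. a \<in> I \<Longrightarrow> b \<in> carrier S \<Longrightarrow>
       maximals_containing S a = maximals_containing S b \<Longrightarrow> b \<in> I"
  using assms by (auto simp: z_ideal_def)

context csemiring
begin

lemma semiring_ideal_mult_right:
  "semiring_ideal S I \<Longrightarrow> s \<in> carrier S \<Longrightarrow> a \<in> I \<Longrightarrow> a \<otimes> s \<in> I"
  using semiring_idealD(2,5) m_comm by metis

lemma semiring_ideal_zero: "semiring_ideal S I \<Longrightarrow> \<zero> \<in> I"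
  using semiring_idealD(2,3,5) l_null zero_closed by (metis ex_in_conv)

lemma semiring_ideal_one: "semiring_ideal S I \<Longrightarrow> \<one> \<in> I \<Longrightarrow> I = carrier S"
  using semiring_idealD(1,5) r_one by (metis subset_antisym subsetI)

lemma semiring_ideal_carrier: "semiring_ideal S (carrier S)"
  by (auto simp: semiring_ideal_def)

lemma semiring_ideal_finsum:
  assumes I: "semiring_ideal S I" and "finite F" "\<And>i. i \<in> F \<Longrightarrow> x i \<in> I"
  shows "finsum S x F \<in> I"
  using assms(2,3)
proof (induction F rule: finite_induct)
  case empty
  then show ?case using semiring_ideal_zero[OF I] by simp
next
  case (insert i F)
  have "x \<in> F \<rightarrow> carrier S" "x i \<in> carrier S"
    using insert.prems semiring_idealD(2)[OF I] by auto
  then show ?case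
    using insert semiring_idealD(4)[OF I] by (simp add: finsum_insert)
qed

text \<open>This is the ideal generated by \<open>M\<close> and \<open>a\<close> in explicit form,
  so that maximality of \<open>M\<close> can be turned into an equation for
  \<open>\<one>\<close>.\<close>

lemma semiring_ideal_adjoin:
  assumes M: "semiring_ideal S M" and a: "a \<in> carrier S"
  shows "semiring_ideal S {m \<oplus> s \<otimes> a | m s. m \<in> M \<and> s \<in> carrier S}" (is "semiring_ideal S ?J")
  unfolding semiring_ideal_def
proof (intro conjI ballI)
  note Mc = semiring_idealD(2)[OF M]
  show "?J \<subseteq> carrier S" using Mc a by auto
  show "?J \<noteq> {}" using semiring_ideal_zero[OF M] by blast
  fix x assume "x \<in> ?J"
  then obtain m s where x: "x = m \<oplus> s \<otimes> a" "m \<in> M" "s \<in> carrier S" by blast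
  {
    fix y assume "y \<in> ?J"
    then obtain n t where y: "y = n \<oplus> t \<otimes> a" "n \<in> M" "t \<in> carrier S" by blast
    have "x \<oplus> y = (m \<oplus> n) \<oplus> (s \<oplus> t) \<otimes> a"
      using x y a Mc by (simp add: l_distr a_ac)
    moreover have "m \<oplus> n \<in> M" "s \<oplus> t \<in> carrier S"
      using x y semiring_idealD(4)[OF M] by auto
    ultimately show "x \<oplus> y \<in> ?J" by blast
  next
    fix r assume r: "r \<in> carrier S"
    have "r \<otimes> x = r \<otimes> m \<oplus> (r \<otimes> s) \<otimes> a"
      using x r a Mc by (simp add: r_distr m_assoc)
    moreover have "r \<otimes> m \<in> M" "r \<otimes> s \<in> carrier S"
      using x r semiring_idealD(5)[OF M] by auto
    ultimately show "r \<otimes> x \<in> ?J" by blast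
  }
qed

text \<open>The usual ring argument survives without subtraction: if \<open>b \<notin> M\<close>,
  adjoining \<open>b\<close> to \<open>M\<close> yields
  \<open>\<one> = m \<oplus> s \<otimes> b\<close>, and multiplying by \<open>a\<close> writes
  \<open>a\<close> as a sum of two elements of \<open>M\<close>.\<close>

lemma maximal_semiring_ideal_prime:
  assumes M: "maximal_semiring_ideal S M"
    and a: "a \<in> carrier S" and b: "b \<in> carrier S" and ab: "a \<otimes> b \<in> M"
  shows "a \<in> M \<or> b \<in> M"
proof (rule disjCI)
  assume "b \<notin> M"
  have id: "semiring_ideal S M"
    and max: "\<And>J. semiring_ideal S J \<Longrightarrow> M \<subseteq> J \<Longrightarrow> J = M \<or> J = carrier S"
    using M by (auto simp: maximal_semiring_ideal_def)
  note Mc = semiring_idealD(2)[OF id]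
  let ?J = "{m \<oplus> s \<otimes> b | m s. m \<in> M \<and> s \<in> carrier S}"
  have "m \<in> ?J" if "m \<in> M" for m
    using that Mc b by (intro CollectI exI[of _ m] exI[of _ \<zero>]) auto
  then have "M \<subseteq> ?J" by blast
  moreover have "b \<in> ?J"
    using semiring_ideal_zero[OF id] b by (intro CollectI exI[of _ \<zero>] exI[of _ \<one>]) auto
  ultimately have "?J = carrier S"
    using max[OF semiring_ideal_adjoin[OF id b]] \<open>b \<notin> M\<close> by blast
  then have "\<one> \<in> ?J" by simp
  then obtain m s where one: "\<one> = m \<oplus> s \<otimes> b" and ms: "m \<in> M" "s \<in> carrier S" by blast
  have "a = a \<otimes> (m \<oplus> s \<otimes> b)" using a by (simp flip: one)
  also have "\<dots> = a \<otimes> m \<oplus> s \<otimes> (a \<otimes> b)"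
    using a b ms Mc by (simp add: r_distr m_ac)
  also have "\<dots> \<in> M"
    using semiring_idealD(4,5)[OF id] a ms ab by blast
  finally show "a \<in> M" .
qed

text \<open>Primality of maximal ideals enters the development through this identity: it shows that
  \<open>x \<otimes> x\<close> and \<open>x\<close> lie in the same maximal ideals and that
  multiplication by \<open>x\<close> preserves equality of such families.\<close>

lemma maximals_containing_mult:
  assumes "a \<in> carrier S" "b \<in> carrier S"
  shows "maximals_containing S (a \<otimes> b) = maximals_containing S a \<union> maximals_containing S b"
proof -
  have "a \<otimes> b \<in> M \<longleftrightarrow> a \<in> M \<or> b \<in> M" if M: "maximal_semiring_ideal S M" for M
  proof -
    have "semiring_ideal S M" using M by (simp add: maximal_semiring_ideal_def)
    then show ?thesis
      using assms maximal_semiring_ideal_prime[OF M] semiring_idealD(5) semiring_ideal_mult_right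
      by metis
  qed
  then show ?thesis by (auto simp: maximals_containing_def)
qed

section \<open>The z-closure operator\<close>

lemma z_idealI:
  assumes "I \<subseteq> carrier S" "\<zero> \<in> I"
    "\<And>a b. a \<in> I \<Longrightarrow> b \<in> I \<Longrightarrow> a \<oplus> b \<in> I"
    "\<And>s a. s \<in> carrier S \<Longrightarrow> a \<in> I \<Longrightarrow> s \<otimes> a \<in> I"
    "\<And>a b. a \<in> I \<Longrightarrow> b \<in> carrier S \<Longrightarrow>
       maximals_containing S a = maximals_containing S b \<Longrightarrow> b \<in> I"
  shows "z_ideal S I"
  unfolding z_ideal_def
proof (intro conjI ballI impI)
  show "semiring_ideal S I" unfolding semiring_ideal_def using assms(1-4) by blast
qed (rule assms(5))

lemma z_ideal_carrier: "z_ideal S (carrier S)"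
  by (auto simp: z_ideal_def semiring_ideal_carrier)

lemma z_ideal_subset: "z_ideal S I \<Longrightarrow> I \<subseteq> carrier S"
  using z_idealD(1) semiring_idealD(1) by blast

text \<open>Nonemptiness matters: the intersection of the empty family is the whole type rather than
  \<open>carrier S\<close>.\<close>

lemma z_ideal_Inter:
  assumes ne: "\<J> \<noteq> {}" and z: "\<And>J. J \<in> \<J> \<Longrightarrow> z_ideal S J"
  shows "z_ideal S (\<Inter>\<J>)"
proof (rule z_idealI)
  note id = z_idealD(1)[OF z]
  show "\<Inter>\<J> \<subseteq> carrier S" using ne z_ideal_subset[OF z] by blast
  show "\<zero> \<in> \<Inter>\<J>" using semiring_ideal_zero[OF id] by blast
  show "a \<oplus> b \<in> \<Inter>\<J>" if "a \<in> \<Inter>\<J>" "b \<in> \<Inter>\<J>" for a b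
    using semiring_idealD(4)[OF id] that by blast
  show "s \<otimes> a \<in> \<Inter>\<J>" if "s \<in> carrier S" "a \<in> \<Inter>\<J>" for s a
    using semiring_idealD(5)[OF id] that by blast
  show "b \<in> \<Inter>\<J>"
    if "a \<in> \<Inter>\<J>" "b \<in> carrier S" "maximals_containing S a = maximals_containing S b" for a b
    using z_idealD(2)[OF z _ that(2,3)] that(1) by blast
qed

text \<open>Each condition on a z-ideal involves at most two of its elements, and directedness
  places these in a common member. Used for finite generation and for chains in Zorn's
  lemma.\<close>

lemma z_ideal_directed_Union:
  assumes ne: "\<J> \<noteq> {}" and z: "\<And>J. J \<in> \<J> \<Longrightarrow> z_ideal S J"
    and dir: "\<And>I J. I \<in> \<J> \<Longrightarrow> J \<in> \<J> \<Longrightarrow> \<exists>K\<in>\<J>. I \<union> J \<subseteq> K"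
  shows "z_ideal S (\<Union>\<J>)"
proof (rule z_idealI)
  note id = z_idealD(1)[OF z]
  show "\<Union>\<J> \<subseteq> carrier S" using z_ideal_subset[OF z] by blast
  show "\<zero> \<in> \<Union>\<J>" using ne semiring_ideal_zero[OF id] by blast
  show "a \<oplus> b \<in> \<Union>\<J>" if ab: "a \<in> \<Union>\<J>" "b \<in> \<Union>\<J>" for a b
  proof -
    obtain K where K: "K \<in> \<J>" "a \<in> K" "b \<in> K" using ab dir by blast
    then show ?thesis using semiring_idealD(4)[OF id] by blast
  qed
  show "s \<otimes> a \<in> \<Union>\<J>" if "s \<in> carrier S" "a \<in> \<Union>\<J>" for s a
    using semiring_idealD(5)[OF id] that by blast
  show "b \<in> \<Union>\<J>"
    if "a \<in> \<Union>\<J>" "b \<in> carrier S" "maximals_containing S a = maximals_containing S b" for a b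
    using z_idealD(2)[OF z _ that(2,3)] that(1) by blast
qed

text \<open>By \<open>maximals_containing_mult\<close>, if \<open>a\<close> and \<open>b\<close> lie
  in the same maximal ideals then so do \<open>x \<otimes> a\<close> and
  \<open>x \<otimes> b\<close>.\<close>

lemma z_ideal_colon:
  assumes K: "z_ideal S K" and x: "x \<in> carrier S"
  shows "z_ideal S {y \<in> carrier S. x \<otimes> y \<in> K}" (is "z_ideal S ?C")
proof (rule z_idealI)
  note id = z_idealD(1)[OF K]
  show "?C \<subseteq> carrier S" by blast
  show "\<zero> \<in> ?C" using semiring_ideal_zero[OF id] x by simp
  show "a \<oplus> b \<in> ?C" if "a \<in> ?C" "b \<in> ?C" for a b
    using semiring_idealD(4)[OF id] that x by (simp add: r_distr)
  show "s \<otimes> a \<in> ?C" if "s \<in> carrier S" "a \<in> ?C" for s a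
    using semiring_idealD(5)[OF id that(1)] that x by (simp add: m_lcomm)
  show "b \<in> ?C"
    if "a \<in> ?C" "b \<in> carrier S" "maximals_containing S a = maximals_containing S b" for a b
    using z_idealD(2)[OF K, of "x \<otimes> a" "x \<otimes> b"] that x
    by (simp add: maximals_containing_mult)
qed

lemma z_ideal_square:
  assumes "z_ideal S K" "x \<in> carrier S" "x \<otimes> x \<in> K"
  shows "x \<in> K"
  using z_idealD(2)[OF assms(1,3,2)] assms(2) by (simp add: maximals_containing_mult)

section \<open>Closures, their generators and joins\<close>

lemma z_ideal_z_closure: "X \<subseteq> carrier S \<Longrightarrow> z_ideal S (z_closure S X)"
  unfolding z_closure_def using z_ideal_carrier by (intro z_ideal_Inter) auto

lemma z_closure_superset: "X \<subseteq> z_closure S X"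
  by (auto simp: z_closure_def)

lemma z_closure_minimal: "z_ideal S J \<Longrightarrow> X \<subseteq> J \<Longrightarrow> z_closure S X \<subseteq> J"
  by (auto simp: z_closure_def)

lemma z_closure_mono: "X \<subseteq> Y \<Longrightarrow> z_closure S X \<subseteq> z_closure S Y"
  by (auto simp: z_closure_def)

lemma z_closure_subset_iff:
  "Y \<subseteq> carrier S \<Longrightarrow> z_closure S X \<subseteq> z_closure S Y \<longleftrightarrow> X \<subseteq> z_closure S Y"
  using z_closure_superset z_closure_minimal z_ideal_z_closure by blast

lemma z_closure_z_ideal: "z_ideal S I \<Longrightarrow> z_closure S I = I"
  using z_closure_superset z_closure_minimal by blast

lemma z_closure_subset_carrier: "X \<subseteq> carrier S \<Longrightarrow> z_closure S X \<subseteq> carrier S"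
  using z_ideal_subset z_ideal_z_closure by blast

lemma z_closure_Un_z_closures:
  assumes "F \<subseteq> carrier S"
  shows "z_closure S (\<Union>a\<in>F. z_closure S {a}) = z_closure S F"
proof
  show "z_closure S (\<Union>a\<in>F. z_closure S {a}) \<subseteq> z_closure S F"
    using assms z_closure_mono[of "{_}" F] by (subst z_closure_subset_iff) blast+
  show "z_closure S F \<subseteq> z_closure S (\<Union>a\<in>F. z_closure S {a})"
    using z_closure_superset by (intro z_closure_mono) blast
qed

text \<open>Every z-ideal contains \<open>\<zero>\<close>, so a generating set can always be made
  nonempty.\<close>

lemma z_closure_insert_zero:
  assumes "F \<subseteq> carrier S"
  shows "z_closure S (insert \<zero> F) = z_closure S F"
proof
  show "z_closure S (insert \<zero> F) \<subseteq> z_closure S F"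
    using assms z_closure_superset[of F]
      semiring_ideal_zero[OF z_idealD(1)[OF z_ideal_z_closure[OF assms]]]
    by (subst z_closure_subset_iff) auto
qed (intro z_closure_mono subset_insertI)

text \<open>A z-ideal contains \<open>PIdl a\<close> exactly when it contains \<open>a\<close>, so
  both closures intersect the same family.\<close>

lemma principal_z_closure_eq:
  assumes a: "a \<in> carrier S"
  shows "principal_z_closure S a = z_closure S {a}"
proof -
  have "PIdl a \<subseteq> J \<longleftrightarrow> {a} \<subseteq> J" if "z_ideal S J" for J
  proof
    assume "PIdl a \<subseteq> J"
    moreover have "\<one> \<otimes> a \<in> PIdl a" unfolding cgenideal_def by blast
    ultimately show "{a} \<subseteq> J" using a by auto
  next
    assume "{a} \<subseteq> J"
    then show "PIdl a \<subseteq> J"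
      unfolding cgenideal_def using semiring_idealD(5)[OF z_idealD(1)[OF that]] by blast
  qed
  then show ?thesis
    unfolding principal_z_closure_def z_closure_def by (metis (no_types, lifting))
qed

text \<open>A z-ideal contains the sum exactly when it contains every summand: one-term sums give
  one direction, closure under finite sums the other. Joins thereby become closures of plain
  unions.\<close>

lemma z_join_eq:
  assumes sub: "\<Union>\<I> \<subseteq> carrier S"
  shows "z_join S \<I> = z_closure S (\<Union>\<I>)"
proof -
  have "ideal_sum S \<I> \<subseteq> J \<longleftrightarrow> \<Union>\<I> \<subseteq> J" if J: "z_ideal S J" for J
  proof
    assume L: "ideal_sum S \<I> \<subseteq> J"
    have "a \<in> ideal_sum S \<I>" if "I \<in> \<I>" "a \<in> I" for I a
    proof -
      have "finsum S (\<lambda>_. a) {I} = a"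
        using that sub by (subst finsum_insert) auto
      then show ?thesis
        unfolding ideal_sum_def using that
        by (intro CollectI exI[of _ "\<lambda>_. a"] exI[of _ "{I}"]) auto
    qed
    with L show "\<Union>\<I> \<subseteq> J" by blast
  next
    assume R: "\<Union>\<I> \<subseteq> J"
    have "finsum S x \<F> \<in> J" if "finite \<F>" "\<F> \<subseteq> \<I>" "\<forall>I\<in>\<F>. x I \<in> I" for x \<F>
      using R that by (intro semiring_ideal_finsum[OF z_idealD(1)[OF J]]) blast+
    then show "ideal_sum S \<I> \<subseteq> J" by (auto simp: ideal_sum_def)
  qed
  then show ?thesis
    unfolding z_join_def z_closure_def by (metis (no_types, lifting))
qed

section \<open>Algebraicity and multiplicativity of the closure operator\<close>

lemma z_closure_algebraic:
  assumes X: "X \<subseteq> carrier S" and a: "a \<in> z_closure S X"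
  shows "\<exists>F\<subseteq>X. finite F \<and> a \<in> z_closure S F"
proof -
  let ?\<J> = "z_closure S ` {F. F \<subseteq> X \<and> finite F}"
  have "z_ideal S (\<Union>?\<J>)"
  proof (rule z_ideal_directed_Union)
    show "?\<J> \<noteq> {}" by auto
    show "z_ideal S J" if "J \<in> ?\<J>" for J using that X z_ideal_z_closure by auto
    fix I J assume "I \<in> ?\<J>" "J \<in> ?\<J>"
    then obtain F G where "F \<subseteq> X" "finite F" "I = z_closure S F"
      "G \<subseteq> X" "finite G" "J = z_closure S G" by auto
    then show "\<exists>K\<in>?\<J>. I \<union> J \<subseteq> K"
      using z_closure_mono[of F "F \<union> G"] z_closure_mono[of G "F \<union> G"]
      by (intro bexI[of _ "z_closure S (F \<union> G)"] imageI) auto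
  qed
  moreover have "X \<subseteq> \<Union>?\<J>"
  proof
    fix x assume "x \<in> X"
    then show "x \<in> \<Union>?\<J>"
      using z_closure_superset[of "{x}"] by (intro UnionI[of "z_closure S {x}"] imageI) auto
  qed
  ultimately have "a \<in> \<Union>?\<J>" using a z_closure_minimal by blast
  then show ?thesis by auto
qed

lemma z_closure_algebraic_finite:
  assumes X: "X \<subseteq> carrier S" and "finite F" "F \<subseteq> z_closure S X"
  shows "\<exists>G\<subseteq>X. finite G \<and> F \<subseteq> z_closure S G"
  using assms(2,3)
proof (induction F rule: finite_induct)
  case (insert a F)
  then obtain G H where "G \<subseteq> X" "finite G" "F \<subseteq> z_closure S G"
    "H \<subseteq> X" "finite H" "a \<in> z_closure S H"
    using z_closure_algebraic[OF X, of a] by auto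
  then show ?case
    using z_closure_mono[of G "G \<union> H"] z_closure_mono[of H "G \<union> H"]
    by (intro exI[of _ "G \<union> H"]) auto
qed auto

text \<open>The inclusion into \<open>?K\<close> extends products from generators to closures one
  factor at a time, since a quotient of \<open>?K\<close> by an element is a z-ideal: containing the
  generators, it contains their closure.\<close>

lemma z_closure_Int:
  assumes X: "X \<subseteq> carrier S" and Y: "Y \<subseteq> carrier S"
  shows "z_closure S X \<inter> z_closure S Y = z_closure S {x \<otimes> y | x y. x \<in> X \<and> y \<in> Y}"
    (is "_ = ?K")
proof
  have K: "z_ideal S ?K" using X Y by (intro z_ideal_z_closure) auto
  have 1: "x \<otimes> y \<in> ?K" if x: "x \<in> X" and y: "y \<in> z_closure S Y" for x y
  proof -
    have "Y \<subseteq> {y \<in> carrier S. x \<otimes> y \<in> ?K}"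
      using x Y z_closure_superset[of "{x \<otimes> y | x y. x \<in> X \<and> y \<in> Y}"] by blast
    from z_closure_minimal[OF z_ideal_colon[OF K] this] x X y show ?thesis by blast
  qed
  \<comment> \<open>The factors are swapped because \<open>z_ideal_colon\<close> keeps the fixed
    element on the left; now \<open>y\<close> is fixed and \<open>x\<close> varies.\<close>
  have 2: "y \<otimes> x \<in> ?K" if x: "x \<in> z_closure S X" and y: "y \<in> z_closure S Y" for x y
  proof -
    have yc: "y \<in> carrier S" using y Y z_closure_subset_carrier by blast
    then have "X \<subseteq> {x \<in> carrier S. y \<otimes> x \<in> ?K}"
      using X 1[OF _ y] m_comm[OF yc] by auto
    from z_closure_minimal[OF z_ideal_colon[OF K yc] this] x show ?thesis by blast
  qed
  \<comment> \<open>An element of both closures may serve as both factors in \<open>2\<close>, so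
    its square lies in \<open>?K\<close>, and then so does the element.\<close>
  show "z_closure S X \<inter> z_closure S Y \<subseteq> ?K"
    using 2 z_ideal_square[OF K] z_closure_subset_carrier[OF X] by blast
  have "x \<otimes> y \<in> z_closure S X \<inter> z_closure S Y" if "x \<in> X" "y \<in> Y" for x y
    using that X Y z_closure_superset[of X] z_closure_superset[of Y]
      semiring_ideal_mult_right[OF z_idealD(1)[OF z_ideal_z_closure[OF X]]]
      semiring_idealD(5)[OF z_idealD(1)[OF z_ideal_z_closure[OF Y]]] by blast
  then have "{x \<otimes> y | x y. x \<in> X \<and> y \<in> Y} \<subseteq> z_closure S X \<inter> z_closure S Y" by auto
  then show "?K \<subseteq> z_closure S X \<inter> z_closure S Y"
    by (intro Int_greatest z_closure_minimal z_ideal_z_closure X Y) simp_all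
qed

section \<open>The frame of z-ideals\<close>

lemma ZId_simps [simp]:
  "carrier (ZId S) = {I. z_ideal S I}"
  "(.=\<^bsub>ZId S\<^esub>) = (=)"
  "(\<sqsubseteq>\<^bsub>ZId S\<^esub>) = (\<subseteq>)"
  by (simp_all add: ZId_def)

lemma partial_order_ZId: "partial_order (ZId S)"
  by unfold_locales auto

lemma Union_subset_carrier: "\<A> \<subseteq> {I. z_ideal S I} \<Longrightarrow> \<Union>\<A> \<subseteq> carrier S"
  using z_ideal_subset by blast

lemma least_ZId:
  assumes "\<A> \<subseteq> {I. z_ideal S I}"
  shows "least (ZId S) (z_closure S (\<Union>\<A>)) (Upper (ZId S) \<A>)"
proof (rule least_UpperI)
  show "I \<sqsubseteq>\<^bsub>ZId S\<^esub> z_closure S (\<Union>\<A>)" if "I \<in> \<A>" for I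
    using z_closure_superset[of "\<Union>\<A>"] that by auto
  show "z_closure S (\<Union>\<A>) \<sqsubseteq>\<^bsub>ZId S\<^esub> J" if "J \<in> Upper (ZId S) \<A>" for J
    using z_closure_minimal[of J "\<Union>\<A>"] that assms by (force simp: Upper_def)
qed (use assms z_ideal_z_closure[OF Union_subset_carrier[OF assms]] in auto)

lemma greatest_ZId:
  assumes "\<A> \<subseteq> {I. z_ideal S I}" "\<A> \<noteq> {}"
  shows "greatest (ZId S) (\<Inter>\<A>) (Lower (ZId S) \<A>)"
proof (rule greatest_LowerI)
  show "J \<sqsubseteq>\<^bsub>ZId S\<^esub> \<Inter>\<A>" if "J \<in> Lower (ZId S) \<A>" for J
    using that assms by (force simp: Lower_def)
qed (use assms z_ideal_Inter[of \<A>] in auto)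

text \<open>This supplies the infimum of the empty family, left out of \<open>greatest_ZId\<close>,
  and later identifies the top element.\<close>

lemma greatest_ZId_carrier: "greatest (ZId S) (carrier S) {I. z_ideal S I}"
  using z_ideal_carrier z_ideal_subset by (auto simp: greatest_def)

lemma complete_lattice_ZId: "complete_lattice (ZId S)"
proof -
  interpret partial_order "ZId S" by (rule partial_order_ZId)
  show ?thesis
  proof (unfold_locales, goal_cases)
    case (1 A)
    then show ?case using least_ZId by auto
  next
    case (2 A)
    then show ?case
      using greatest_ZId[of A] greatest_ZId_carrier by (cases "A = {}") (auto simp: Lower_def)
  qed
qed

lemma ZId_sup:
  assumes "\<A> \<subseteq> {I. z_ideal S I}"
  shows "\<Squnion>\<^bsub>ZId S\<^esub>\<A> = z_closure S (\<Union>\<A>)"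
proof -
  interpret complete_lattice "ZId S" by (rule complete_lattice_ZId)
  show ?thesis using least_unique[OF sup_lub least_ZId] assms by simp
qed

lemma ZId_meet:
  assumes "z_ideal S I" "z_ideal S J"
  shows "I \<sqinter>\<^bsub>ZId S\<^esub> J = I \<inter> J"
proof -
  interpret complete_lattice "ZId S" by (rule complete_lattice_ZId)
  show ?thesis
    unfolding meet_def using greatest_unique[OF inf_glb greatest_ZId, of "{I, J}"] assms by simp
qed

lemma ZId_top: "\<top>\<^bsub>ZId S\<^esub> = carrier S"
proof -
  interpret complete_lattice "ZId S" by (rule complete_lattice_ZId)
  show ?thesis using greatest_unique[OF top_greatest] greatest_ZId_carrier by simp
qed

lemma frame_ZId: "frame (ZId S)"
proof -
  interpret complete_lattice "ZId S" by (rule complete_lattice_ZId)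
  show ?thesis
  proof
    fix I \<B> assume "I \<in> carrier (ZId S)" "\<B> \<subseteq> carrier (ZId S)"
    then have I: "z_ideal S I" and \<B>: "\<B> \<subseteq> {J. z_ideal S J}" by auto
    note c = z_ideal_subset[OF I] Union_subset_carrier[OF \<B>]
    have z: "z_ideal S (I \<inter> J)" if "J \<in> \<B>" for J
      using z_ideal_Inter[of "{I, J}"] I \<B> that by auto
    \<comment> \<open>Rewriting \<open>I\<close> as its own closure makes
      \<open>z_closure_Int\<close> applicable.\<close>
    have "I \<sqinter>\<^bsub>ZId S\<^esub> \<Squnion>\<^bsub>ZId S\<^esub>\<B> = z_closure S I \<inter> z_closure S (\<Union>\<B>)"
      by (simp add: ZId_sup[OF \<B>] ZId_meet[OF I z_ideal_z_closure] c z_closure_z_ideal[OF I])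
    also have "\<dots> = z_closure S (\<Union>J\<in>\<B>. I \<inter> J)"
    proof
      have "{x \<otimes> y | x y. x \<in> I \<and> y \<in> \<Union>\<B>} \<subseteq> (\<Union>J\<in>\<B>. I \<inter> J)"
      proof clarify
        fix x y J assume xy: "x \<in> I" "y \<in> J" and J: "J \<in> \<B>"
        then have id: "semiring_ideal S I" "semiring_ideal S J" using I \<B> z_idealD(1) by auto
        then have "x \<otimes> y \<in> I \<inter> J"
          using semiring_ideal_mult_right[OF id(1) _ xy(1)] semiring_idealD(5)[OF id(2) _ xy(2)]
            semiring_idealD(2)[OF id(1) xy(1)] semiring_idealD(2)[OF id(2) xy(2)] by simp
        with J show "x \<otimes> y \<in> (\<Union>J\<in>\<B>. I \<inter> J)" by blast
      qed
      then show "z_closure S I \<inter> z_closure S (\<Union>\<B>) \<subseteq> z_closure S (\<Union>J\<in>\<B>. I \<inter> J)"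
        unfolding z_closure_Int[OF c] by (rule z_closure_mono)
      show "z_closure S (\<Union>J\<in>\<B>. I \<inter> J) \<subseteq> z_closure S I \<inter> z_closure S (\<Union>\<B>)"
        by (intro Int_greatest z_closure_mono) auto
    qed
    also have "\<dots> = \<Squnion>\<^bsub>ZId S\<^esub>((\<lambda>J. I \<sqinter>\<^bsub>ZId S\<^esub> J) ` \<B>)"
    proof -
      have "(\<lambda>J. I \<sqinter>\<^bsub>ZId S\<^esub> J) ` \<B> = (\<lambda>J. I \<inter> J) ` \<B>"
        using \<B> ZId_meet[OF I] by (intro image_cong) auto
      then show ?thesis using z by (simp add: ZId_sup image_subset_iff)
    qed
    finally show "I \<sqinter>\<^bsub>ZId S\<^esub> \<Squnion>\<^bsub>ZId S\<^esub>\<B> = \<Squnion>\<^bsub>ZId S\<^esub>((\<lambda>J. I \<sqinter>\<^bsub>ZId S\<^esub> J) ` \<B>)" .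
  qed
qed

text \<open>A compact \<open>K\<close> is the join of the closures of its single elements, and a
  finite subfamily gives the generators. Conversely, algebraicity places \<open>F\<close> in the
  closure of a finite part of the union, which meets only finitely many members in a chosen
  cover.\<close>

lemma compact_element_ZId_iff:
  "compact_element (ZId S) K \<longleftrightarrow> (\<exists>F\<subseteq>carrier S. finite F \<and> K = z_closure S F)"
proof
  assume K: "compact_element (ZId S) K"
  then have zK: "z_ideal S K" by (simp add: compact_element_def)
  note c = z_ideal_subset[OF zK]
  let ?\<A> = "(\<lambda>a. z_closure S {a}) ` K"
  have \<A>: "?\<A> \<subseteq> {I. z_ideal S I}" using c z_ideal_z_closure by auto
  have "K \<subseteq> \<Squnion>\<^bsub>ZId S\<^esub>?\<A>"
    using z_closure_Un_z_closures[OF c] z_closure_superset[of K] by (simp add: ZId_sup[OF \<A>])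
  then obtain \<A>' where \<A>': "\<A>' \<subseteq> ?\<A>" "finite \<A>'" "K \<subseteq> \<Squnion>\<^bsub>ZId S\<^esub>\<A>'"
    using K \<A> unfolding compact_element_def by auto
  \<comment> \<open>A finite subset of an image is the image of a finite subset.\<close>
  then obtain F where F: "F \<subseteq> K" "finite F" "\<A>' = (\<lambda>a. z_closure S {a}) ` F"
    by (meson finite_subset_image)
  with c have Fc: "F \<subseteq> carrier S" by blast
  have "K \<subseteq> z_closure S F"
    using \<A>' \<A> F(3) z_closure_Un_z_closures[OF Fc] ZId_sup[of \<A>'] by auto
  moreover have "z_closure S F \<subseteq> K" using z_closure_minimal[OF zK F(1)] .
  ultimately show "\<exists>F\<subseteq>carrier S. finite F \<and> K = z_closure S F" using F Fc by blast
next
  assume "\<exists>F\<subseteq>carrier S. finite F \<and> K = z_closure S F"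
  then obtain F where F: "F \<subseteq> carrier S" "finite F" and K: "K = z_closure S F" by blast
  have "\<exists>\<A>'\<subseteq>\<A>. finite \<A>' \<and> K \<subseteq> \<Squnion>\<^bsub>ZId S\<^esub>\<A>'"
    if \<A>: "\<A> \<subseteq> {I. z_ideal S I}" and le: "K \<subseteq> \<Squnion>\<^bsub>ZId S\<^esub>\<A>" for \<A>
  proof -
    have "F \<subseteq> z_closure S (\<Union>\<A>)"
      using le K z_closure_superset[of F] ZId_sup[OF \<A>] by blast
    then obtain G where G: "G \<subseteq> \<Union>\<A>" "finite G" "F \<subseteq> z_closure S G"
      using z_closure_algebraic_finite[OF Union_subset_carrier[OF \<A>] F(2)] by blast
    obtain \<A>' where \<A>': "finite \<A>'" "\<A>' \<subseteq> \<A>" "G \<subseteq> \<Union>\<A>'"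
      using finite_subset_Union[OF G(2,1)] by blast
    with \<A> have \<A>'z: "\<A>' \<subseteq> {I. z_ideal S I}" by blast
    have "K \<subseteq> z_closure S (\<Union>\<A>')"
      unfolding K z_closure_subset_iff[OF Union_subset_carrier[OF \<A>'z]]
      using G(3) z_closure_mono[OF \<A>'(3)] by blast
    with \<A>'(1,2) show ?thesis
      unfolding ZId_sup[OF \<A>'z, symmetric] by (intro exI[of _ \<A>'] conjI)
  qed
  then show "compact_element (ZId S) K"
    using z_ideal_z_closure[OF F(1)] by (simp add: compact_element_def K)
qed

section \<open>Coherence and the description of the compact elements\<close>

lemma finite_products:
  assumes "finite F" "finite G"
  shows "finite {x \<otimes> y | x y. x \<in> F \<and> y \<in> G}"
  using finite_image_set2[of "\<lambda>x. x \<in> F" "\<lambda>y. y \<in> G" "(\<otimes>)"] assms by simp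

lemma products_subset_carrier:
  "F \<subseteq> carrier S \<Longrightarrow> G \<subseteq> carrier S \<Longrightarrow> {x \<otimes> y | x y. x \<in> F \<and> y \<in> G} \<subseteq> carrier S"
  by auto

lemma carrier_eq_z_closure_one: "carrier S = z_closure S {\<one>}"
  using semiring_ideal_one z_idealD(1) z_ideal_z_closure[of "{\<one>}"] z_closure_superset[of "{\<one>}"]
  by auto

lemma coherent_frame_ZId: "coherent_frame (ZId S)"
proof -
  interpret frame "ZId S" by (rule frame_ZId)
  show ?thesis
  proof
    show "compact_element (ZId S) \<top>\<^bsub>ZId S\<^esub>"
      unfolding ZId_top compact_element_ZId_iff
      using carrier_eq_z_closure_one by (intro exI[of _ "{\<one>}"]) auto
  next
    fix I assume "I \<in> carrier (ZId S)"
    then have I: "z_ideal S I" by simp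
    note c = z_ideal_subset[OF I]
    let ?\<A> = "(\<lambda>a. z_closure S {a}) ` I"
    have "compact_element (ZId S) (z_closure S {a})" if "a \<in> I" for a
      unfolding compact_element_ZId_iff using c that by (intro exI[of _ "{a}"]) auto
    then have "?\<A> \<subseteq> {K. compact_element (ZId S) K}" by blast
    moreover have "I = \<Squnion>\<^bsub>ZId S\<^esub>?\<A>"
      using c z_ideal_z_closure z_closure_Un_z_closures[OF c] z_closure_z_ideal[OF I]
      by (subst ZId_sup) auto
    ultimately show "\<exists>A\<subseteq>{K. compact_element (ZId S) K}. I = \<Squnion>\<^bsub>ZId S\<^esub>A" by blast
  next
    fix K L assume "compact_element (ZId S) K" "compact_element (ZId S) L"
    then obtain F G where F: "F \<subseteq> carrier S" "finite F" "K = z_closure S F"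
      and G: "G \<subseteq> carrier S" "finite G" "L = z_closure S G"
      unfolding compact_element_ZId_iff by blast
    \<comment> \<open>By multiplicativity the meet is generated by the pairwise products of
      generators, a finite set.\<close>
    then have "K \<sqinter>\<^bsub>ZId S\<^esub> L = z_closure S {x \<otimes> y | x y. x \<in> F \<and> y \<in> G}"
      by (simp add: ZId_meet z_ideal_z_closure z_closure_Int)
    then show "compact_element (ZId S) (K \<sqinter>\<^bsub>ZId S\<^esub> L)"
      unfolding compact_element_ZId_iff
      using finite_products[OF F(2) G(2)] products_subset_carrier[OF F(1) G(1)] by blast
  qed
qed

text \<open>Bridges finite joins of principal closures and closures of finite sets, the form in
  which compact elements were characterised.\<close>

lemma z_join_principal_z_closures:
  assumes "a \<in> N \<rightarrow> carrier S"
  shows "z_join S ((\<lambda>i. principal_z_closure S (a i)) ` N) = z_closure S (a ` N)"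
proof -
  have "(\<lambda>i. principal_z_closure S (a i)) ` N = (\<lambda>x. z_closure S {x}) ` a ` N"
    using assms by (auto simp: image_image principal_z_closure_eq Pi_iff intro!: image_cong)
  moreover have "a ` N \<subseteq> carrier S" using assms by auto
  moreover from this have "(\<Union>x\<in>a ` N. z_closure S {x}) \<subseteq> carrier S"
    using z_closure_subset_carrier by blast
  ultimately show ?thesis by (metis z_join_eq z_closure_Un_z_closures)
qed

lemma compact_elements_ZId:
  "{K. compact_element (ZId S) K} =
     {z_join S ((\<lambda>i. principal_z_closure S (a i)) ` {1..n}) | (n::nat) a.
        1 \<le> n \<and> a \<in> {1..n} \<rightarrow> carrier S}" (is "_ = ?R")
proof (intro Set.set_eqI iffI)
  fix K assume "K \<in> {K. compact_element (ZId S) K}"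
  then obtain F where F: "F \<subseteq> carrier S" "finite F" "K = z_closure S F"
    by (auto simp: compact_element_ZId_iff)
  \<comment> \<open>Adjoining \<open>\<zero>\<close> guarantees \<open>n \<ge> 1\<close>.\<close>
  let ?G = "insert \<zero> F"
  obtain a where a: "bij_betw a {1..card ?G} ?G"
    using ex_bij_betw_nat_finite_1[of ?G] F by auto
  then have im: "a ` {1..card ?G} = ?G" by (rule bij_betw_imp_surj_on)
  have ac: "a \<in> {1..card ?G} \<rightarrow> carrier S"
    unfolding image_subset_iff_funcset[symmetric] im using F by simp
  have "K = z_join S ((\<lambda>i. principal_z_closure S (a i)) ` {1..card ?G})"
    unfolding z_join_principal_z_closures[OF ac] im using F by (simp add: z_closure_insert_zero)
  moreover have "1 \<le> card ?G" using F by (simp add: Suc_leI card_gt_0_iff)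
  ultimately show "K \<in> ?R" using ac by blast
next
  fix K assume "K \<in> ?R"
  then obtain n :: nat and a where a: "a \<in> {1..n} \<rightarrow> carrier S"
    and K: "K = z_join S ((\<lambda>i. principal_z_closure S (a i)) ` {1..n})" by blast
  have "K = z_closure S (a ` {1..n})" unfolding K by (rule z_join_principal_z_closures[OF a])
  moreover have "a ` {1..n} \<subseteq> carrier S" using a by auto
  ultimately show "K \<in> {K. compact_element (ZId S) K}"
    unfolding compact_element_ZId_iff mem_Collect_eq by blast
qed

section \<open>The prime z-spectrum\<close>

text \<open>A z-ideal \<open>P\<close> maximal among those containing \<open>K\<close> and avoiding
  \<open>a\<close> is prime: if \<open>b\<close> and \<open>c\<close> were outside \<open>P\<close>,
  then \<open>a\<close> would lie in the closures of \<open>P\<close> enlarged by \<open>b\<close>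
  and by \<open>c\<close>, and multiplicativity would force \<open>a\<close> into \<open>P\<close>
  once \<open>b \<otimes> c \<in> P\<close>.\<close>

lemma prime_z_ideal_avoiding:
  assumes K: "z_ideal S K" and a: "a \<notin> K" "a \<in> carrier S"
  shows "\<exists>P\<in>Spec_z S. K \<subseteq> P \<and> a \<notin> P"
proof -
  let ?\<A> = "{J. z_ideal S J \<and> K \<subseteq> J \<and> a \<notin> J}"
  have "\<exists>P\<in>?\<A>. \<forall>X\<in>?\<A>. P \<subseteq> X \<longrightarrow> X = P"
  proof (rule subset_Zorn_nonempty)
    show "?\<A> \<noteq> {}" using K a by blast
    fix \<C> assume ne: "\<C> \<noteq> {}" and ch: "subset.chain ?\<A> \<C>"
    then have sub: "\<C> \<subseteq> ?\<A>" and lin: "\<And>X Y. X \<in> \<C> \<Longrightarrow> Y \<in> \<C> \<Longrightarrow> X \<subseteq> Y \<or> Y \<subseteq> X"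
      by (auto simp: subset_chain_def)
    have "z_ideal S (\<Union>\<C>)"
    proof (rule z_ideal_directed_Union[OF ne])
      show "z_ideal S J" if "J \<in> \<C>" for J using sub that by blast
      show "\<exists>K\<in>\<C>. I \<union> J \<subseteq> K" if "I \<in> \<C>" "J \<in> \<C>" for I J
        using lin[OF that] that by (metis Un_least subset_refl)
    qed
    then show "\<Union>\<C> \<in> ?\<A>" using sub ne by blast
  qed
  then obtain P where P: "z_ideal S P" "K \<subseteq> P" "a \<notin> P"
    and max: "\<And>X. z_ideal S X \<Longrightarrow> a \<notin> X \<Longrightarrow> P \<subseteq> X \<Longrightarrow> X = P"
    by (smt (verit) mem_Collect_eq subset_trans)
  note id = z_idealD(1)[OF P(1)]
  \<comment> \<open>Otherwise this closure would be a z-ideal above \<open>P\<close> avoiding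
    \<open>a\<close>, hence equal to \<open>P\<close>, although it contains
    \<open>b\<close>.\<close>
  have in_cl: "a \<in> z_closure S (insert b P)" if "b \<in> carrier S" "b \<notin> P" for b
    using max[OF z_ideal_z_closure[of "insert b P"]] that z_closure_superset[of "insert b P"]
      z_ideal_subset[OF P(1)] by blast
  have "b \<in> P \<or> c \<in> P" if b: "b \<in> carrier S" and c: "c \<in> carrier S" and bc: "b \<otimes> c \<in> P" for b c
  proof (rule ccontr)
    assume "\<not> (b \<in> P \<or> c \<in> P)"
    then have "a \<in> z_closure S (insert b P) \<inter> z_closure S (insert c P)"
      using in_cl b c by blast
    moreover have "\<dots> = z_closure S {x \<otimes> y | x y. x \<in> insert b P \<and> y \<in> insert c P}"
      using b c z_ideal_subset[OF P(1)] by (intro z_closure_Int) auto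
    \<comment> \<open>Every such product other than \<open>b \<otimes> c\<close> has a factor in
      \<open>P\<close>.\<close>
    moreover have "{x \<otimes> y | x y. x \<in> insert b P \<and> y \<in> insert c P} \<subseteq> P"
      using b c bc semiring_idealD(2,5)[OF id] semiring_ideal_mult_right[OF id] by auto
    ultimately show False using z_closure_minimal[OF P(1)] P(3) by blast
  qed
  moreover have "P \<noteq> carrier S" using P(3) a by blast
  ultimately have "P \<in> Spec_z S"
    using P id by (auto simp: Spec_z_def prime_semiring_ideal_def)
  with P show ?thesis by blast
qed

section \<open>Hulls and quasi-compact open sets\<close>

lemma Spec_z_z_ideal: "P \<in> Spec_z S \<Longrightarrow> z_ideal S P"
  by (simp add: Spec_z_def)

lemma Spec_z_subset: "P \<in> Spec_z S \<Longrightarrow> P \<subseteq> carrier S"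
  by (intro z_ideal_subset Spec_z_z_ideal)

text \<open>A Nullstellensatz for z-ideals: \<open>z_closure S A\<close> is the intersection of the
  prime z-ideals containing \<open>A\<close>. It translates inclusions of closed sets into
  statements about closures.\<close>

lemma z_hull_subset_iff:
  assumes A: "A \<subseteq> carrier S" and B: "B \<subseteq> carrier S"
  shows "z_hull S A \<subseteq> z_hull S B \<longleftrightarrow> B \<subseteq> z_closure S A"
proof
  assume L: "z_hull S A \<subseteq> z_hull S B"
  show "B \<subseteq> z_closure S A"
  proof (rule ccontr)
    assume "\<not> B \<subseteq> z_closure S A"
    then obtain b where b: "b \<in> B" "b \<notin> z_closure S A" by blast
    then obtain P where "P \<in> Spec_z S" "z_closure S A \<subseteq> P" "b \<notin> P"
      using prime_z_ideal_avoiding[OF z_ideal_z_closure[OF A]] B by blast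
    then show False using L b z_closure_superset[of A] by (auto simp: z_hull_def)
  qed
next
  assume "B \<subseteq> z_closure S A"
  then show "z_hull S A \<subseteq> z_hull S B"
    using z_closure_minimal[OF Spec_z_z_ideal, of _ A] by (force simp: z_hull_def)
qed

text \<open>A cover by complements of the hulls of \<open>A U\<close> means that \<open>F\<close>
  lies in the closure of the union of all \<open>A U\<close>. Algebraicity leaves a finite
  \<open>G\<close> in that union, and finitely many \<open>U\<close> already account for
  \<open>G\<close>.\<close>

lemma compactin_hull_kernel:
  assumes F: "F \<subseteq> carrier S" "finite F"
  shows "compactin (hull_kernel_topology S) (Spec_z S - z_hull S F)"
  unfolding compactin_def
proof (intro conjI allI impI)
  show "Spec_z S - z_hull S F \<subseteq> topspace (hull_kernel_topology S)"
    by (auto simp: topspace_hull_kernel)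
  fix \<U>
  assume "(\<forall>U\<in>\<U>. openin (hull_kernel_topology S) U) \<and> Spec_z S - z_hull S F \<subseteq> \<Union>\<U>"
  then have cover: "Spec_z S - z_hull S F \<subseteq> \<Union>\<U>"
    and "\<forall>U\<in>\<U>. \<exists>A\<subseteq>carrier S. U = Spec_z S - z_hull S A"
    by (auto simp: openin_hull_kernel)
  then obtain A where A: "\<And>U. U \<in> \<U> \<Longrightarrow> A U \<subseteq> carrier S \<and> U = Spec_z S - z_hull S (A U)"
    by metis
  have mem: "P \<in> U \<longleftrightarrow> P \<in> Spec_z S \<and> \<not> A U \<subseteq> P" if "U \<in> \<U>" for P U
    using A[OF that] by (auto simp: z_hull_def)
  have Ac: "(\<Union>U\<in>\<U>. A U) \<subseteq> carrier S" using A by blast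
  \<comment> \<open>A prime containing every \<open>A U\<close> lies in no member of the cover,
    hence in the hull of \<open>F\<close>.\<close>
  have "z_hull S (\<Union>U\<in>\<U>. A U) \<subseteq> z_hull S F"
  proof
    fix P assume P: "P \<in> z_hull S (\<Union>U\<in>\<U>. A U)"
    then have "P \<notin> \<Union>\<U>" using mem by (auto simp: z_hull_def)
    with P cover show "P \<in> z_hull S F" by (auto simp: z_hull_def)
  qed
  then obtain G where G: "G \<subseteq> (\<Union>U\<in>\<U>. A U)" "finite G" "F \<subseteq> z_closure S G"
    using z_closure_algebraic_finite[OF Ac F(2)] by (auto simp: z_hull_subset_iff[OF Ac F(1)])
  have Gc: "G \<subseteq> carrier S" using G Ac by blast
  obtain \<F> where \<F>: "\<F> \<subseteq> \<U>" "finite \<F>" "G \<subseteq> (\<Union>U\<in>\<F>. A U)"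
    using finite_subset_Union[OF G(2,1)] by (metis finite_subset_image)
  have "Spec_z S - z_hull S F \<subseteq> \<Union>\<F>"
  proof
    fix P assume "P \<in> Spec_z S - z_hull S F"
    then have P: "P \<in> Spec_z S" "P \<notin> z_hull S G"
      using G(3) z_hull_subset_iff[OF Gc F(1)] by auto
    then have "\<not> G \<subseteq> P" by (simp add: z_hull_def)
    then obtain U where "U \<in> \<F>" "\<not> A U \<subseteq> P" using \<F>(3) by blast
    with P mem \<F>(1) show "P \<in> \<Union>\<F>" by blast
  qed
  with \<F> show "\<exists>\<F>. finite \<F> \<and> \<F> \<subseteq> \<U> \<and> Spec_z S - z_hull S F \<subseteq> \<Union>\<F>" by blast
qed

section \<open>Sobriety and spectrality\<close>

lemma z_hull_one: "z_hull S {\<one>} = {}"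
  using semiring_ideal_one
  by (auto simp: z_hull_def Spec_z_def prime_semiring_ideal_def)

lemma closure_of_hull_kernel:
  assumes P: "P \<in> Spec_z S"
  shows "hull_kernel_topology S closure_of {P} = z_hull S P"
proof (rule closure_of_unique)
  show "{P} \<subseteq> z_hull S P" using P by (simp add: z_hull_def)
  show "closedin (hull_kernel_topology S) (z_hull S P)"
    using Spec_z_subset[OF P] by (auto simp: closedin_hull_kernel)
  fix T assume "{P} \<subseteq> T" "closedin (hull_kernel_topology S) T"
  then show "z_hull S P \<subseteq> T"
    by (auto simp: closedin_hull_kernel z_hull_def)
qed

text \<open>The generic point of \<open>C\<close> is the intersection of its points. If it contains
  \<open>a \<otimes> b\<close>, the points of \<open>C\<close> containing \<open>a\<close> and those
  containing \<open>b\<close> are two closed sets covering \<open>C\<close>, so irreducibility makes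
  one of them all of \<open>C\<close>.\<close>

lemma Inter_irreducible_closed:
  assumes C: "irreducible_closed (hull_kernel_topology S) C"
  shows "\<Inter>C \<in> Spec_z S" "C = z_hull S (\<Inter>C)"
proof -
  obtain A where A: "A \<subseteq> carrier S" "C = z_hull S A" and ne: "C \<noteq> {}"
    using C by (auto simp: irreducible_closed_def closedin_hull_kernel)
  have CS: "C \<subseteq> Spec_z S" using A by (auto simp: z_hull_def)
  let ?P = "\<Inter>C"
  have z: "z_ideal S ?P" using ne CS Spec_z_z_ideal by (intro z_ideal_Inter) blast+
  note Pc = z_ideal_subset[OF z]
  show hull: "C = z_hull S ?P" using A by (auto simp: z_hull_def)
  have "a \<in> ?P \<or> b \<in> ?P" if ab: "a \<in> carrier S" "b \<in> carrier S" "a \<otimes> b \<in> ?P" for a b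
  proof -
    have prime: "a \<in> Q \<or> b \<in> Q" if "Q \<in> C" for Q
      using ab that CS by (auto simp: Spec_z_def prime_semiring_ideal_def)
    let ?D = "z_hull S (insert a ?P)" and ?E = "z_hull S (insert b ?P)"
    have "z_hull S (insert c ?P) = {Q \<in> z_hull S ?P. c \<in> Q}" for c
      by (auto simp: z_hull_def)
    then have "?D = {Q \<in> C. a \<in> Q}" "?E = {Q \<in> C. b \<in> Q}"
      unfolding hull[symmetric] by simp_all
    then have "C = ?D \<union> ?E" "C = ?D \<Longrightarrow> a \<in> ?P" "C = ?E \<Longrightarrow> b \<in> ?P"
      using prime by blast+
    moreover have "closedin (hull_kernel_topology S) ?D" "closedin (hull_kernel_topology S) ?E"
      unfolding closedin_hull_kernel using ab Pc by blast+
    ultimately show ?thesis using C unfolding irreducible_closed_def by meson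
  qed
  moreover have "?P \<noteq> carrier S"
  proof -
    obtain Q where Q: "Q \<in> C" "Q \<in> Spec_z S" using ne CS by blast
    have "Q \<noteq> carrier S" using Q(2) by (simp add: Spec_z_def prime_semiring_ideal_def)
    with Spec_z_subset[OF Q(2)] Q(1) show ?thesis by blast
  qed
  ultimately show "?P \<in> Spec_z S"
    using z z_idealD(1)[OF z] by (simp add: Spec_z_def prime_semiring_ideal_def)
qed

lemma sober_hull_kernel: "sober_space (hull_kernel_topology S)"
  unfolding sober_space_def topspace_hull_kernel
proof (intro allI impI ex1I)
  fix C assume C: "irreducible_closed (hull_kernel_topology S) C"
  note P = Inter_irreducible_closed[OF C]
  show "\<Inter>C \<in> Spec_z S \<and> hull_kernel_topology S closure_of {\<Inter>C} = C"
    using P closure_of_hull_kernel by simp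
  fix Q assume Q: "Q \<in> Spec_z S \<and> hull_kernel_topology S closure_of {Q} = C"
  then have "C = z_hull S Q" using closure_of_hull_kernel[of Q] by simp
  \<comment> \<open>\<open>Q\<close> is itself the least element of its hull, so the intersection
    recovers it.\<close>
  then show "Q = \<Inter>C" using Q by (auto simp: z_hull_def)
qed

lemma spectral_hull_kernel: "spectral_space (hull_kernel_topology S)"
  unfolding spectral_space_def
proof (intro conjI sober_hull_kernel exI)
  \<comment> \<open>By \<open>z_hull_subset_iff\<close> these sets depend only on
    \<open>z_closure S F\<close>: they are the open sets given by the compact elements of the
    frame.\<close>
  let ?\<B> = "{Spec_z S - z_hull S F | F. F \<subseteq> carrier S \<and> finite F}"
  \<comment> \<open>No prime contains \<open>\<one>\<close>, so the whole space is the basic open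
    set of \<open>{\<one>}\<close>.\<close>
  show "compact_space (hull_kernel_topology S)"
    using compactin_hull_kernel[of "{\<one>}"]
    by (simp add: compact_space_def topspace_hull_kernel z_hull_one)
  show "\<forall>U\<in>?\<B>. openin (hull_kernel_topology S) U \<and> compactin (hull_kernel_topology S) U"
    using compactin_hull_kernel openin_hull_kernel by blast
  show "\<forall>U. openin (hull_kernel_topology S) U \<longrightarrow> (\<exists>\<U>\<subseteq>?\<B>. U = \<Union>\<U>)"
  proof (intro allI impI)
    fix U assume "openin (hull_kernel_topology S) U"
    then obtain A where A: "A \<subseteq> carrier S" "U = Spec_z S - z_hull S A"
      by (auto simp: openin_hull_kernel)
    let ?\<U> = "(\<lambda>a. Spec_z S - z_hull S {a}) ` A"
    have "?\<U> \<subseteq> ?\<B>" using A by blast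
    moreover have "U = \<Union>?\<U>" using A by (auto simp: z_hull_def)
    ultimately show "\<exists>\<U>\<subseteq>?\<B>. U = \<Union>\<U>" by blast
  qed
  show "\<forall>U\<in>?\<B>. \<forall>V\<in>?\<B>. U \<inter> V \<in> ?\<B>"
  proof (intro ballI)
    fix U V assume "U \<in> ?\<B>" "V \<in> ?\<B>"
    then obtain F G where F: "F \<subseteq> carrier S" "finite F" "U = Spec_z S - z_hull S F"
      and G: "G \<subseteq> carrier S" "finite G" "V = Spec_z S - z_hull S G" by blast
    have "U \<inter> V = Spec_z S - z_hull S {x \<otimes> y | x y. x \<in> F \<and> y \<in> G}"
      unfolding F G z_hull_Un[OF F(1) G(1), symmetric] by blast
    then show "U \<inter> V \<in> ?\<B>"
      using finite_products[OF F(2) G(2)] products_subset_carrier[OF F(1) G(1)] by blast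
  qed
qed

end

theorem theorem2:
  fixes S :: "('a, 'm) ring_scheme" (structure)
  assumes "csemiring S"
  shows "coherent_frame (ZId S) \<and>
    {K. compact_element (ZId S) K} =
      {z_join S ((\<lambda>i. principal_z_closure S (a i)) ` {1..n}) | (n::nat) a.
         1 \<le> n \<and> a \<in> {1..n} \<rightarrow> carrier S} \<and>
    spectral_space (hull_kernel_topology S)"
  using csemiring.coherent_frame_ZId[OF assms] csemiring.compact_elements_ZId[OF assms]
    csemiring.spectral_hull_kernel[OF assms]
  by blast

end
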